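(* Let $D$ be a reflexive multipartite tournament. The following statements are equivalent. 1. $D$ is strongly chordal. 2. $D$ is an $\mathcal F_r$-free transitive orientation of a complete split graph, where $\mathcal F_r=\{T_{202},T_{1111},T_{10101}\}$. 3. $D$ is a transitive orientation of a complete split graph, with split partition $(T,S)$, such that all vertices in $S$, except possibly one, lie in two consecutive levels.
   Context: Digraphs are finite, without parallel arcs; a digraph is reflexive if every vertex has a loop. A strong ordering of a digraph $D$ is a linear ordering $v_1,\dots,v_n$ of $V(D)$ such that for all $i<j$ and $k<\ell$ (not necessarily distinct), if $(v_i,v_k),(v_i,v_\ell),(v_j,v_k)\in A(D)$ then $(v_j,v_\ell)\in A(D)$. A digraph is strongly chordal if it has a strong ordering. A reflexive multipartite tournament is obtained from a complete multipartite graph by orienting each edge in exactly one direction and adding a loop at every vertex. A complete split graph is a graph whose vertex set has a partition $(T,S)$ (split partition) with $T$ a clique, $S$ an independent set, and every vertex of $S$ adjacent to every vertex of $T$. A (reflexive) transitive orientation of a complete split graph with split partition $(T,S)$ means here: the graph's edges are each oriented in one direction, all loops are present, and, ignoring loops, $T$ induces a transitive tournament and for every $s\in S$ the set $T\cup\{s\}$ induces a transitive tournament. Thus, if $t_1,\dots,t_m$ is the topological ordering of $T$ ($t_1$ the source), each $s\in S$ has in-neighbours $t_1,\dots,t_i$ and out-neighbours $t_{i+1},\dots,t_m$ (besides itself) for some $i\in\{0,\dots,m\}$; $i$ is called the level of $s$. Levels $i$ and $i+1$ are consecutive. For a sequence $c_0c_1\cdots c_m$ of nonnegative integers, $T_{c_0c_1\cdots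 c_m}$ denotes the reflexive transitive orientation of a complete split graph with $|T|=m$ and exactly $c_i$ vertices of $S$ in level $i$, for $0\le i\le m$. In particular, $T_{202}$ has $|T|=2$, $|S|=4$; $T_{1111}$ has $|T|=3$, $|S|=4$; $T_{10101}$ has $|T|=4$, $|S|=3$. $\mathcal F_r$-free means having no induced subdigraph isomorphic to a member of $\mathcal F_r$. *)

theory Defs
  imports Graph_Theory.Graph_Theory "HOL-Library.Disjoint_Sets"
begin

text \<open>
  Finite digraphs without parallel arcs (loops allowed) are the \<open>pair_fin_digraph\<close>s,
  finite simple graphs are the \<open>pair_graph\<close>s (symmetric and loopless).
\<close>

definition strong_ordering :: "'a pair_pre_digraph \<Rightarrow> 'a list \<Rightarrow> bool" where
  "strong_ordering D vs \<longleftrightarrow> distinct vs \<and> set vs = pverts D \<and>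
     (\<forall>i j k l. i < j \<and> j < length vs \<and> k < l \<and> l < length vs \<and>
        (vs ! i, vs ! k) \<in> parcs D \<and> (vs ! i, vs ! l) \<in> parcs D \<and> (vs ! j, vs ! k) \<in> parcs D
        \<longrightarrow> (vs ! j, vs ! l) \<in> parcs D)"

definition strongly_chordal :: "'a pair_pre_digraph \<Rightarrow> bool" where
  "strongly_chordal D \<longleftrightarrow> (\<exists>vs. strong_ordering D vs)"

definition reflexive_orientation :: "'a pair_pre_digraph \<Rightarrow> 'a pair_pre_digraph \<Rightarrow> bool" where
  "reflexive_orientation D H \<longleftrightarrow> pverts D = pverts H \<and>
     Id_on (pverts H) \<subseteq> parcs D \<and> parcs D \<subseteq> parcs H \<union> Id_on (pverts H) \<and>
     (\<forall>(u, v) \<in> parcs H. (u, v) \<in> parcs D \<longleftrightarrow> (v, u) \<notin> parcs D)"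

definition complete_multipartite :: "'a pair_pre_digraph \<Rightarrow> bool" where
  "complete_multipartite H \<longleftrightarrow> pair_graph H \<and>
     (\<exists>P. partition_on (pverts H) P \<and>
        parcs H = {(u, v). \<exists>A\<in>P. \<exists>B\<in>P. A \<noteq> B \<and> u \<in> A \<and> v \<in> B})"

definition reflexive_multipartite_tournament :: "'a pair_pre_digraph \<Rightarrow> bool" where
  "reflexive_multipartite_tournament D \<longleftrightarrow>
     (\<exists>H. complete_multipartite H \<and> reflexive_orientation D H)"

text \<open>Either side of a split partition may be empty.\<close>

definition split_partition :: "'a pair_pre_digraph \<Rightarrow> 'a set \<Rightarrow> 'a set \<Rightarrow> bool" where
  "split_partition H T S \<longleftrightarrow> T \<union> S = pverts H \<and> T \<inter> S = {} \<and>
     (\<forall>u\<in>T. \<forall>v\<in>T. u \<noteq> v \<longrightarrow> (u, v) \<in> parcs H) \<and>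
     (\<forall>u\<in>S. \<forall>v\<in>S. (u, v) \<notin> parcs H) \<and>
     (\<forall>s\<in>S. \<forall>t\<in>T. (s, t) \<in> parcs H)"

definition induces_transitive_tournament :: "'a pair_pre_digraph \<Rightarrow> 'a set \<Rightarrow> bool" where
  "induces_transitive_tournament D X \<longleftrightarrow>
     total_on X (parcs D - Id) \<and> asym_on X (parcs D - Id) \<and> trans_on X (parcs D - Id)"

definition transitive_split_orientation ::
    "'a pair_pre_digraph \<Rightarrow> 'a set \<Rightarrow> 'a set \<Rightarrow> bool" where
  "transitive_split_orientation D T S \<longleftrightarrow>
     (\<exists>H. pair_graph H \<and> split_partition H T S \<and> reflexive_orientation D H) \<and>
     induces_transitive_tournament D T \<and>
     (\<forall>s\<in>S. induces_transitive_tournament D (insert s T))"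

definition topological_ordering :: "'a pair_pre_digraph \<Rightarrow> 'a set \<Rightarrow> 'a list \<Rightarrow> bool" where
  "topological_ordering D T ts \<longleftrightarrow>
     distinct ts \<and> set ts = T \<and> sorted_wrt (\<lambda>u v. (u, v) \<in> parcs D) ts"

definition in_level :: "'a pair_pre_digraph \<Rightarrow> 'a set \<Rightarrow> nat \<Rightarrow> 'a \<Rightarrow> bool" where
  "in_level D T i s \<longleftrightarrow> (\<exists>ts. topological_ordering D T ts \<and> i \<le> length ts \<and>
     {u \<in> T. (u, s) \<in> parcs D} = set (take i ts) \<and>
     {u \<in> T. (s, u) \<in> parcs D} = set (drop i ts))"

text \<open>
  \<open>T_seq [c\<^sub>0, \<dots>, c\<^sub>m]\<close>: the clique side is \<open>Inl 1, \<dots>, Inl m\<close> in topological order, and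
  \<open>Inr (i, k)\<close> with \<open>k < c\<^sub>i\<close> are the vertices of the independent side in level \<open>i\<close>.
\<close>

definition T_seq :: "nat list \<Rightarrow> (nat + nat \<times> nat) pair_pre_digraph" where
  "T_seq c = (let T = Inl ` {1..<length c};
                  S = {Inr (i, k) | i k. i < length c \<and> k < c ! i}
     in \<lparr> pverts = T \<union> S,
          parcs = Id_on (T \<union> S) \<union>
            {(Inl p, Inl q) | p q. Inl p \<in> T \<and> Inl q \<in> T \<and> p < q} \<union>
            {(Inl p, Inr (i, k)) | p i k. Inl p \<in> T \<and> Inr (i, k) \<in> S \<and> p \<le> i} \<union>
            {(Inr (i, k), Inl p) | p i k. Inl p \<in> T \<and> Inr (i, k) \<in> S \<and> i < p} \<rparr>)"

lemma T_seq_props: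
  assumes "c \<noteq> []"
  obtains T S where "transitive_split_orientation (T_seq c) T S" "card T = length c - 1"
    "\<And>i. i < length c \<Longrightarrow> card {s \<in> S. in_level (T_seq c) T i s} = c ! i"
proof -
  define n where "n = length c"
  have n: "n > 0" using assms by (simp add: n_def)
  define T :: "(nat + nat \<times> nat) set" where "T = Inl ` {1..<n}"
  define S :: "(nat + nat \<times> nat) set" where "S = {Inr (i, k) | i k. i < n \<and> k < c ! i}"
  let ?D = "T_seq c"
  have V: "pverts ?D = T \<union> S"
    by (simp add: T_seq_def Let_def T_def S_def n_def)
  have A: "parcs ?D = Id_on (T \<union> S) \<union>
            {(Inl p, Inl q) | p q. Inl p \<in> T \<and> Inl q \<in> T \<and> p < q} \<union>
            {(Inl p, Inr (i, k)) | p i k. Inl p \<in> T \<and> Inr (i, k) \<in> S \<and> p \<le> i} \<union>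
            {(Inr (i, k), Inl p) | p i k. Inl p \<in> T \<and> Inr (i, k) \<in> S \<and> i < p}"
    by (simp add: T_seq_def Let_def T_def S_def n_def)
  have mem:
    "(Inl p, Inl q) \<in> parcs ?D \<longleftrightarrow> 1 \<le> p \<and> q < n \<and> p \<le> q"
    "(Inl p, Inr (i, k)) \<in> parcs ?D \<longleftrightarrow> 1 \<le> p \<and> p \<le> i \<and> i < n \<and> k < c ! i"
    "(Inr (i, k), Inl p) \<in> parcs ?D \<longleftrightarrow> i < p \<and> p < n \<and> k < c ! i"
    "(Inr (i, k), Inr (j, l)) \<in> parcs ?D \<longleftrightarrow> i = j \<and> k = l \<and> i < n \<and> k < c ! i"
    for p q i j k l
    by (auto simp: A T_def S_def Id_on_iff)
  have "S \<subseteq> (\<Union>i<n. (\<lambda>k. Inr (i, k)) ` {..<c ! i})"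
    by (auto simp: S_def)
  then have fin: "finite (T \<union> S)"
    by (auto simp: T_def intro: finite_subset)
  define H where "H = \<lparr> pverts = T \<union> S,
    parcs = {(u, v). u \<noteq> v \<and> (u \<in> T \<and> v \<in> T \<union> S \<or> u \<in> S \<and> v \<in> T)} \<rparr>"
  have finH: "finite (parcs H)"
    by (rule finite_subset[of _ "(T \<union> S) \<times> (T \<union> S)"]) (use fin in \<open>auto simp: H_def simp del: finite_Un\<close>)
  have disj: "T \<inter> S = {}" by (auto simp: T_def S_def)
  have "pair_graph H"
    by unfold_locales
      (use fin finH in \<open>auto simp: H_def symmetric_def sym_def\<close>)
  moreover have "split_partition H T S"
    unfolding split_partition_def H_def using disj by auto
  moreover have "reflexive_orientation ?D H"
  proof -
    have "Id_on (T \<union> S) \<subseteq> parcs ?D" unfolding A by blast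
    moreover have "parcs ?D \<subseteq> parcs H \<union> Id_on (T \<union> S)"
    proof (rule subrelI)
      fix u v assume "(u, v) \<in> parcs ?D"
      then show "(u, v) \<in> parcs H \<union> Id_on (T \<union> S)"
        by (cases u; cases v) (auto simp: H_def mem T_def S_def)
    qed
    moreover have "(u, v) \<in> parcs ?D \<longleftrightarrow> (v, u) \<notin> parcs ?D" if "(u, v) \<in> parcs H" for u v
      using that by (cases u; cases v) (auto simp: H_def mem T_def S_def)
    ultimately show ?thesis
      unfolding reflexive_orientation_def by (auto simp: V H_def)
  qed
  moreover have trn: "induces_transitive_tournament ?D (insert s T)" if "s \<in> T \<union> S" for s
  proof -
    have "total_on (insert s T) (parcs ?D - Id)"
      unfolding total_on_def using that by (auto simp: T_def S_def mem)
    moreover have "asym_on (insert s T) (parcs ?D - Id)"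
      unfolding asym_on_def using that by (auto simp: T_def S_def mem)
    moreover have "trans_on (insert s T) (parcs ?D - Id)"
      unfolding trans_on_def using that by (auto simp: T_def S_def mem)
    ultimately show ?thesis unfolding induces_transitive_tournament_def by blast
  qed
  moreover have "induces_transitive_tournament ?D T"
  proof (cases "T = {}")
    case True
    then show ?thesis by (simp add: induces_transitive_tournament_def asym_on_def trans_on_def)
  next
    case False
    then show ?thesis using trn by (metis Un_iff ex_in_conv insert_absorb)
  qed
  ultimately have "transitive_split_orientation ?D T S"
    unfolding transitive_split_orientation_def by blast
  moreover have "card T = length c - 1"
    by (simp add: T_def card_image n_def)
  moreover have "card {s \<in> S. in_level ?D T i s} = c ! i" if i: "i < length c" for i
  proof -
    have lev: "in_level ?D T j (Inr (j, k))" if "Inr (j, k) \<in> S" for j k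
    proof -
      have jn: "j < n" using that by (auto simp: S_def)
      let ?ts = "map Inl [1..<n] :: (nat + nat \<times> nat) list"
      have "topological_ordering ?D T ?ts"
        unfolding topological_ordering_def
        by (auto simp: mem T_def distinct_map sorted_wrt_map sorted_wrt_iff_nth_less)
      moreover have "j \<le> length ?ts" using jn by simp
      moreover have "{u \<in> T. (u, Inr (j, k)) \<in> parcs ?D} = set (take j ?ts)"
        using that by (auto simp: T_def S_def mem take_map)
      moreover have "{u \<in> T. (Inr (j, k), u) \<in> parcs ?D} = set (drop j ?ts)"
        using that by (auto simp: T_def S_def mem drop_map)
      ultimately show ?thesis unfolding in_level_def by blast
    qed
    have num: "i' = card {u \<in> T. (u, s) \<in> parcs ?D}" if "in_level ?D T i' s" for i' s
      using that unfolding in_level_def topological_ordering_def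
      by (auto simp: distinct_card min_def)
    have "{s \<in> S. in_level ?D T i s} = (\<lambda>k. Inr (i, k)) ` {..<c ! i}"
    proof (intro equalityI subsetI)
      fix s assume s: "s \<in> {s \<in> S. in_level ?D T i s}"
      then obtain j k where "s = Inr (j, k)" "k < c ! j" by (auto simp: S_def)
      with s num lev have "j = i" by blast
      then show "s \<in> (\<lambda>k. Inr (i, k)) ` {..<c ! i}"
        using \<open>s = _\<close> \<open>k < _\<close> by auto
    next
      fix s :: "nat + nat \<times> nat" assume "s \<in> (\<lambda>k. Inr (i, k)) ` {..<c ! i}"
      then show "s \<in> {s \<in> S. in_level ?D T i s}"
        using lev i by (auto simp: S_def n_def)
    qed
    then show ?thesis by (simp add: card_image inj_on_def)
  qed
  ultimately show thesis using that by blast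
qed

definition F_r :: "(nat + nat \<times> nat) pair_pre_digraph set" where
  "F_r = {T_seq [2, 0, 2], T_seq [1, 1, 1, 1], T_seq [1, 0, 1, 0, 1]}"

definition F_r_free :: "'a pair_pre_digraph \<Rightarrow> bool" where
  "F_r_free D \<longleftrightarrow> (\<forall>F \<in> F_r.
     \<not> (\<exists>X \<subseteq> pverts D. digraph_iso (with_proj D \<restriction> X) (with_proj F)))"

end

theory Submission
  imports Defs
begin

text \<open>
  In a transitive orientation of a complete split graph, every arc between the clique \<open>T\<close> and
  another vertex is decided by comparing levels, so all three properties become statements about the
  levels of the vertices in \<open>S\<close>.

  In a strong ordering, a common neighbour of two nonadjacent vertices comes after at least one of
  them. Hence the first vertex of an orientation of a 4-cycle cannot exist, and at most one part of
  the tournament has more than one vertex; the first vertex of a directed triangle can be bypassed,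
  so cliques are transitive. For the same reason all vertices of \<open>S\<close> but the last one precede \<open>T\<close>, and
  then their levels must be adjacent to the position of the first vertex of \<open>T\<close>. Conversely, such a
  distribution of levels allows an explicit strong ordering. Sorting the levels, the failure of this
  distribution is witnessed by two vertices at each of two distant levels, by four distinct levels, or
  by three pairwise distant levels, which are the three forbidden subdigraphs.
\<close>

section \<open>Strong orderings as rank functions\<close>

text \<open>Named after the adjacency matrix: with rows and columns sorted by \<open>r\<close>, it
  has no 2x2 submatrix with rows 11 and 10. Integer ranks replace positions in a list so that an
  ordering can be given by a formula with negative values and gaps.\<close>

definition gamma_free_rank :: "'a rel \<Rightarrow> 'a set \<Rightarrow> ('a \<Rightarrow> int) \<Rightarrow> bool" where
  "gamma_free_rank A V r \<longleftrightarrow> inj_on r V \<and>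
     (\<forall>u\<in>V. \<forall>v\<in>V. \<forall>x\<in>V. \<forall>y\<in>V. r u < r v \<and> r x < r y \<and>
        (u, x) \<in> A \<and> (u, y) \<in> A \<and> (v, x) \<in> A \<longrightarrow> (v, y) \<in> A)"

lemma gamma_free_rankD:
  assumes "gamma_free_rank A V r" "u \<in> V" "v \<in> V" "x \<in> V" "y \<in> V"
    "(u, x) \<in> A" "(u, y) \<in> A" "(v, x) \<in> A" "(v, y) \<notin> A"
  shows "\<not> (r u < r v \<and> r x < r y)"
  using assms unfolding gamma_free_rank_def by blast

text \<open>Transposing the matrix exchanges the pairs \<open>u\<close>, \<open>v\<close> and
  \<open>x\<close>, \<open>y\<close>, and the forbidden pattern is symmetric. This allows all arcs
  to be reversed later.\<close>

lemma gamma_free_rank_converse: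
  "gamma_free_rank (A\<inverse>) V r \<longleftrightarrow> gamma_free_rank A V r"
  unfolding gamma_free_rank_def converse_iff by blast

lemma strongly_chordal_iff_rank:
  assumes "finite (pverts D)"
  shows "strongly_chordal D \<longleftrightarrow> (\<exists>r. gamma_free_rank (parcs D) (pverts D) r)"
proof
  assume "strongly_chordal D"
  then obtain vs where ord: "strong_ordering D vs"
    unfolding strongly_chordal_def by blast
  then have vs: "distinct vs" "set vs = pverts D"
    and so: "\<forall>i j k l. i < j \<and> j < length vs \<and> k < l \<and> l < length vs \<and>
        (vs ! i, vs ! k) \<in> parcs D \<and> (vs ! i, vs ! l) \<in> parcs D \<and> (vs ! j, vs ! k) \<in> parcs D
        \<longrightarrow> (vs ! j, vs ! l) \<in> parcs D"
    unfolding strong_ordering_def by blast+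
  have "\<forall>u\<in>pverts D. \<exists>i. i < length vs \<and> vs ! i = u"
    by (simp flip: vs(2) in_set_conv_nth)
  from bchoice[OF this] obtain r where r: "\<And>u. u \<in> pverts D \<Longrightarrow> r u < length vs \<and> vs ! r u = u"
    by blast
  have "inj_on (\<lambda>u. int (r u)) (pverts D)"
    by (rule inj_onI) (use r in \<open>metis of_nat_eq_iff\<close>)
  then have "gamma_free_rank (parcs D) (pverts D) (\<lambda>u. int (r u))"
    unfolding gamma_free_rank_def
  proof (intro conjI ballI impI, goal_cases)
    case (2 u v x y)
    then show ?case using so[rule_format, of "r u" "r v" "r x" "r y"] r by auto
  qed
  then show "\<exists>r. gamma_free_rank (parcs D) (pverts D) r" by blast
next
  assume "\<exists>r. gamma_free_rank (parcs D) (pverts D) r"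
  then obtain r where r: "gamma_free_rank (parcs D) (pverts D) r" by blast
  obtain us where us: "set us = pverts D" "distinct us"
    using finite_distinct_list[OF assms] by blast
  define vs where "vs = sort_key r us"
  have vs: "set vs = pverts D" "distinct vs"
    by (simp_all add: vs_def us)
  have "inj_on r (set vs)"
    using r vs(1) unfolding gamma_free_rank_def by simp
  then have "distinct (map r vs)" using vs(2) by (simp add: distinct_map)
  moreover have "sorted (map r vs)" by (simp add: vs_def)
  ultimately have "sorted_wrt (<) (map r vs)" by (simp add: strict_sorted_iff)
  then have mono: "r (vs ! i) < r (vs ! j)" if "i < j" "j < length vs" for i j
    using that by (auto simp: sorted_wrt_map sorted_wrt_iff_nth_less)
  have "strong_ordering D vs"
    unfolding strong_ordering_def
  proof (intro conjI allI impI, goal_cases)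
    case (3 i j k l)
    then have V: "vs ! i \<in> pverts D" "vs ! j \<in> pverts D" "vs ! k \<in> pverts D" "vs ! l \<in> pverts D"
      using vs(1) nth_mem[of _ vs] by simp_all
    show ?case
      using gamma_free_rankD[OF r V] mono[of i j] mono[of k l] 3 by blast
  qed (use vs in auto)
  then show "strongly_chordal D" unfolding strongly_chordal_def by blast
qed

section \<open>An explicit ordering for levels in two consecutive values, up to one
  exception\<close>

text \<open>Positions \<open>p\<close> and levels \<open>l\<close> are arbitrary integers here, so
  that the lemma applies both to a digraph and, after negation, to its converse. The exception
  \<open>z\<close> only has to lie below the upper value \<open>w\<close>.\<close>

lemma gamma_free_rank_exists:
  fixes p l :: "'a \<Rightarrow> int"
  assumes fin: "finite V" and V: "V = T \<union> S" "T \<inter> S = {}"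
    and TT: "\<And>u v. \<lbrakk>u \<in> T; v \<in> T\<rbrakk> \<Longrightarrow> (u, v) \<in> A \<longleftrightarrow> p u \<le> p v"
    and TS: "\<And>u v. \<lbrakk>u \<in> T; v \<in> S\<rbrakk> \<Longrightarrow> (u, v) \<in> A \<longleftrightarrow> p u \<le> l v"
    and ST: "\<And>u v. \<lbrakk>u \<in> S; v \<in> T\<rbrakk> \<Longrightarrow> (u, v) \<in> A \<longleftrightarrow> l u < p v"
    and SS: "\<And>u v. \<lbrakk>u \<in> S; v \<in> S\<rbrakk> \<Longrightarrow> (u, v) \<in> A \<longleftrightarrow> u = v"
    and inj: "inj_on p T"
    and lev: "\<And>s. \<lbrakk>s \<in> S; s \<noteq> z\<rbrakk> \<Longrightarrow> l s = w - 1 \<or> l s = w"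
    and z: "l z < w"
  shows "\<exists>r. gamma_free_rank A V r"
proof -
  have fT: "finite T" and fS: "finite S" using fin V by auto
  obtain g :: "'a \<Rightarrow> nat" where g: "inj_on g S"
    using finite_imp_inj_to_nat_seg[OF fS] by blast
  \<comment> \<open>A crude upper bound for \<open>p t - w\<close>, used to push the decreasing
    block behind the increasing one. Being a sum, it is 0 for an empty clique.\<close>
  define M where "M = (\<Sum>t\<in>T. \<bar>p t - w\<bar>)"
  have M: "p t - w \<le> M" "0 \<le> M" if "t \<in> T" for t
  proof -
    have "\<bar>p t - w\<bar> \<le> M"
      unfolding M_def by (rule member_le_sum) (use that fT in auto)
    then show "p t - w \<le> M" "0 \<le> M" by auto
  qed
  have M0: "0 \<le> M" unfolding M_def by (rule sum_nonneg) auto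
  txt \<open>
    First \<open>S - {z}\<close>, then the clique with indices \<open>w, w + 1, \<dots>\<close> increasing, followed by the indices
    \<open>w - 1, w - 2, \<dots>\<close> decreasing, where \<open>z\<close> is squeezed in (odd offset) just before index \<open>l z\<close>.
  \<close>
  define r where "r x = (if x \<in> T then if w \<le> p x then p x - w else M + 2 * (w - p x)
      else if x = z then M + 2 * (w - l z) - 1 else - 1 - int (g x))" for x
  have rT: "(w \<le> p t \<and> r t = p t - w \<and> r t \<le> M \<and> 0 \<le> r t) \<or> (p t < w \<and> r t = M + 2 * (w - p t) \<and> M < r t)"
    if "t \<in> T" for t
    using that M[OF that] by (auto simp: r_def)
  have rS: "r s < 0" if "s \<in> S" "s \<noteq> z" for s
    using that V(2) by (auto simp: r_def)
  have rz: "r z = M + 2 * (w - l z) - 1 \<and> M < r z" if "z \<in> S"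
    using that V(2) z by (auto simp: r_def)
  have "inj_on r V"
  proof (rule inj_onI)
    fix u v assume uv: "u \<in> V" "v \<in> V" "r u = r v"
    have *: "r u \<noteq> r v" if "u \<in> T" "v \<in> S" for u v
      proof (cases "v = z")
      case True
      then have "r v = M + 2 * (w - l z) - 1" "M < r v" using rz that(2) by auto
      then show ?thesis using rT[OF that(1)] by presburger
    next
      case False
      then have "r v < 0" using rS that(2) by blast
      then show ?thesis using rT[OF that(1)] M0 by linarith
    qed
    from uv(1,2) V(1) consider "u \<in> T" "v \<in> T" | "u \<in> T" "v \<in> S" | "u \<in> S" "v \<in> T" | "u \<in> S" "v \<in> S"
      by blast
    then show "u = v"
    proof cases
      case 1
      have "p u = p v" using rT[OF 1(1)] rT[OF 1(2)] uv(3) by (smt (verit))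
      then show ?thesis using inj_onD[OF inj] 1 by blast
    next
      case 2
      then show ?thesis using * uv(3) by blast
    next
      case 3
      then show ?thesis using * uv(3) by metis
    next
      case 4
      have "r z \<noteq> r s" if "s \<in> S" "s \<noteq> z" "z \<in> S" for s
        using rS[OF that(1,2)] rz[OF that(3)] M0 by linarith
      moreover have "u = v" if "u \<noteq> z" "v \<noteq> z"
      proof -
        have "u \<notin> T" "v \<notin> T" using 4 V(2) by blast+
        then show ?thesis using that 4 uv(3) inj_onD[OF g, of u v] unfolding r_def by simp
      qed
      ultimately show ?thesis using 4 uv(3) by metis
    qed
  qed
  moreover have "(v, y) \<in> A"
    if "u \<in> V" "v \<in> V" "x \<in> V" "y \<in> V" and lt: "r u < r v" "r x < r y"
      and arcs: "(u, x) \<in> A" "(u, y) \<in> A" "(v, x) \<in> A" for u v x y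
  proof -
    \<comment> \<open>The next four facts, on clique pairs, on the position of \<open>z\<close>
      relative to the clique, and on the initial block \<open>S - {z}\<close>, are all that the case
      analysis uses about the formula for \<open>r\<close>.\<close>
    have oTT: "(w \<le> p a \<and> p a < p b) \<or> (p b < w \<and> p b < p a)" if "a \<in> T" "b \<in> T" "r a < r b" for a b
      using rT[OF that(1)] rT[OF that(2)] that(3) by (smt (verit))
    have oTz: "l z < p a" if "a \<in> T" "z \<in> S" "r a < r z" for a
      using rT[OF that(1)] rz[OF that(2)] that(3) z by (smt (verit))
    have ozT: "p a \<le> l z" if "a \<in> T" "z \<in> S" "r z < r a" for a
      using rT[OF that(1)] rz[OF that(2)] that(3) z by (smt (verit))
    have oS: "b \<in> S \<and> b \<noteq> z" if "a \<in> S" "a \<noteq> z" "b \<in> V" "r b < r a" for a b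
      using rT[of b] rz rS[OF that(1,2)] that(3,4) V M0 by (cases "b \<in> T") auto
    have y: "y \<in> T \<or> y \<in> S" and x: "x \<in> T \<or> x \<in> S" using that V by auto
    from V(1) that(1,2) consider "u \<in> T" "v \<in> T" | "u \<in> T" "v \<in> S" | "u \<in> S" "v \<in> T" | "u \<in> S" "v \<in> S"
      by blast
    then show ?thesis
    proof cases
      case 1
      show ?thesis
      proof (rule ccontr)
        assume n: "(v, y) \<notin> A"
        from y show False
        proof
          assume y: "y \<in> T"
          have "p y < p v" "p u \<le> p y" using 1 y n arcs TT by auto
          \<comment> \<open>Here \<open>p u < p v\<close> although \<open>u\<close> comes first, so
            \<open>u\<close> is in the increasing block. Then \<open>x\<close> would need an arc
            from \<open>v\<close>, which lies beyond \<open>w\<close>: no vertex of \<open>S\<close>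
            has one, and a clique vertex \<open>x\<close> would come after \<open>y\<close>.\<close>
          then have "w \<le> p u" using oTT[OF 1 lt(1)] by linarith
          from x show False
          proof
            assume "x \<in> T"
            then show False using TT[of v x] 1 arcs oTT[of x y] y lt \<open>p y < p v\<close> \<open>w \<le> p u\<close> \<open>p u \<le> p y\<close> by auto
          next
            assume "x \<in> S"
            then show False using TS[of v x] 1 arcs lev[of x] z lt \<open>p y < p v\<close> \<open>w \<le> p u\<close> \<open>p u \<le> p y\<close> 
              by (cases "x = z") auto
          qed
        next
          assume y: "y \<in> S"
          have ly: "l y < p v" "p u \<le> l y" using 1 y n arcs TS by auto
          then have w: "w \<le> p u" using oTT[OF 1 lt(1)] by linarith
          then have "y \<noteq> z" using ly z by auto
          then have "x \<in> S" "x \<noteq> z" using oS[of y x] y that lt by auto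
          then show False using ly w TS[of v x] 1 arcs lev[of x] lev[of y] y \<open>y \<noteq> z\<close> by auto
        qed
      qed
    next
      case 2
      \<comment> \<open>Only \<open>z\<close> can follow a clique vertex, and it follows
        \<open>u\<close> only if it has an arc to \<open>u\<close>, hence to all clique
        out-neighbours of \<open>u\<close>.\<close>
      then have "v = z" using oS[of v u] that(1) lt V(2) by blast
      then have lz: "l z < p u" using oTz 2 lt by blast
      from x show ?thesis
      proof
        assume xT: "x \<in> T"
        then have px: "l z < p x" using ST[of v x] 2 arcs \<open>v = z\<close> by blast
        from y show ?thesis
        proof
          assume "y \<in> T"
          then show ?thesis using TT[of u y] arcs lz ST[of v y] 2 \<open>v = z\<close> by auto
        next
          assume "y \<in> S"
          moreover have "y \<noteq> z" using TS[of u y] 2 \<open>y \<in> S\<close> arcs lz by auto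
          ultimately show ?thesis using oS[of y x] that(3) lt xT V(2) by blast
        qed
      next
        assume "x \<in> S"
        then show ?thesis using SS[of v x] TS[of u x] 2 arcs \<open>v = z\<close> lz by auto
      qed
    next
      case 3
      from x show ?thesis
      proof
        assume xT: "x \<in> T"
        then have lx: "l u < p x" "p v \<le> p x" using ST[of u x] TT[of v x] 3 arcs by auto
        from y show ?thesis
        proof
          assume y: "y \<in> T"
          then have ly: "l u < p y" using ST[of u y] 3 arcs by auto
          show ?thesis
          proof (cases "u = z")
            case True
            then show ?thesis using ozT[of v] 3 lt ly TT[of v y] y by auto
          next
            case False
            \<comment> \<open>Since \<open>l u\<close> is at least \<open>w - 1\<close>, both
              \<open>x\<close> and \<open>y\<close> are in the increasing block, so
              \<open>p x < p y\<close>.\<close>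
            then show ?thesis using lev[of u] 3 lx ly oTT[OF xT y lt(2)] TT[of v y] y by auto
          qed
        next
          assume y: "y \<in> S"
          then have "y = u" using SS 3 arcs by blast
          then have "y = z" using oS[of y x] that(3) lt xT V(2) y by blast
          then show ?thesis using ozT[of v] 3 lt \<open>y = u\<close> TS[of v y] by auto
        qed
      next
        assume "x \<in> S"
        then have "x = u" using SS 3 arcs by blast
        then show ?thesis using y lt 3 arcs TS[of v x] ST[of u y] TT[of v y] SS[of u y] by auto
      qed
    next
      case 4
      then have uz: "u \<noteq> z" using oS[of v u] that(1) lt(1) by auto
      from x show ?thesis
      proof
        assume xT: "x \<in> T"
        then have lx: "l u < p x" "l v < p x" using ST 4 arcs by auto
        from y show ?thesis
        proof
          assume y: "y \<in> T"
          then have ly: "l u < p y" using ST[of u y] 4 arcs by auto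
          show ?thesis
          proof (cases "v = z")
            case True
            then show ?thesis using lev[of u] 4 uz z ly ST[of v y] y by auto
          next
            case False
            then show ?thesis using lev[of u] lev[of v] uz 4 lx ly oTT[OF xT y lt(2)] ST[of v y] y by auto
          qed
        next
          assume "y \<in> S"
          then have "y = u" using SS 4 arcs by blast
          then show ?thesis using oS[of y x] that(3) lt xT V(2) uz 4 by blast
        qed
      next
        assume "x \<in> S"
        then show ?thesis using SS 4 arcs lt by auto
      qed
    qed
  qed
  ultimately show ?thesis unfolding gamma_free_rank_def by blast
qed

section \<open>Local consequences of a strong ordering\<close>

text \<open>If \<open>t\<close> preceded both, then either its own loop (when the two arcs at
  \<open>t\<close> point in different directions) or the loop of the earlier of \<open>s\<close> and
  \<open>s'\<close> completes the premise of the ordering condition, which then forces an arc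
  between \<open>s\<close> and \<open>s'\<close>.\<close>

lemma gamma_free_rank_nonadjacent:
  assumes r: "gamma_free_rank A V r" and V: "s \<in> V" "s' \<in> V" "t \<in> V"
    and loops: "\<And>x. x \<in> V \<Longrightarrow> (x, x) \<in> A"
    and non: "(s, s') \<notin> A" "(s', s) \<notin> A"
    and adj: "(s, t) \<in> A \<or> (t, s) \<in> A" "(s', t) \<in> A \<or> (t, s') \<in> A"
  shows "r s < r t \<or> r s' < r t"
proof (rule ccontr)
  assume "\<not> ?thesis"
  moreover have "r s \<noteq> r s'" "r t \<noteq> r s" "r t \<noteq> r s'"
    using r V loops non adj unfolding gamma_free_rank_def inj_on_def by metis+
  ultimately have lt: "r t < r s" "r t < r s'" "r s < r s' \<or> r s' < r s" by auto
  note G = gamma_free_rankD[OF r]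
  from adj lt(3) show False
    using G[of t s s s'] G[of t s' s' s] G[of s s' t s] G[of s' s t s'] G[of t s t s'] G[of t s' t s]
      V loops lt(1,2) non by (elim disjE) simp_all
qed

text \<open>The loop at \<open>m\<close> supplies the third arc: rows \<open>m\<close>,
  \<open>a\<close> and columns \<open>m\<close>, \<open>b\<close>.\<close>

lemma gamma_free_rank_bypass:
  assumes "gamma_free_rank A V r" "m \<in> V" "a \<in> V" "b \<in> V" "(m, m) \<in> A"
    "(a, m) \<in> A" "(m, b) \<in> A" "r m < r a" "r m < r b"
  shows "(a, b) \<in> A"
  using gamma_free_rankD[OF assms(1), of m a m b] assms(2-) by blast

lemma finite_obtain_min:
  fixes f :: "'a \<Rightarrow> 'b :: linorder"
  assumes "finite S" "S \<noteq> {}"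
  obtains m where "m \<in> S" "\<And>s. s \<in> S \<Longrightarrow> f m \<le> f s"
  using assms arg_min_if_finite(1)[of S f] arg_min_least[of S _ f] by blast

lemma finite_obtain_max:
  fixes f :: "'a \<Rightarrow> 'b :: linorder"
  assumes "finite S" "S \<noteq> {}"
  obtains m where "m \<in> S" "\<And>s. s \<in> S \<Longrightarrow> f s \<le> f m"
proof -
  have "Max (f ` S) \<in> f ` S" using assms by simp
  then obtain m where "m \<in> S" "f m = Max (f ` S)" by auto
  then show thesis using that[of m] assms by simp
qed

section \<open>Levels in split orientations\<close>

locale split_orientation =
  fixes D :: "'a pair_pre_digraph" and T S :: "'a set"
  assumes wf_D: "pair_fin_digraph D"
    and split_D: "transitive_split_orientation D T S"
begin

sublocale pair_fin_digraph D by (rule wf_D)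

text \<open>
  Because of the loops, a clique vertex counts itself, so its level is its 1-based position in the
  topological ordering; for vertices of \<open>S\<close> this is the level of the paper.
\<close>

definition level :: "'a \<Rightarrow> nat" where
  "level x = card {u \<in> T. (u, x) \<in> parcs D}"

lemma verts: "pverts D = T \<union> S" "T \<inter> S = {}"
  using split_D unfolding transitive_split_orientation_def split_partition_def reflexive_orientation_def
  by auto

lemma finite_T: "finite T" and finite_S: "finite S"
  using pair_finite_verts verts by auto

lemma loops: "x \<in> T \<union> S \<Longrightarrow> (x, x) \<in> parcs D"
  using split_D unfolding transitive_split_orientation_def split_partition_def reflexive_orientation_def
  by (auto simp: Id_on_iff)

lemma arc_SS:
  assumes "u \<in> S" "v \<in> S"
  shows "(u, v) \<in> parcs D \<longleftrightarrow> u = v"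
proof -
  obtain H where "split_partition H T S" "reflexive_orientation D H"
    using split_D unfolding transitive_split_orientation_def by blast
  then show ?thesis
    using assms loops[of u] unfolding split_partition_def reflexive_orientation_def by auto
qed

lemma arc_antisym:
  assumes "u \<in> T" "v \<in> T \<union> S" "u \<noteq> v"
  shows "(u, v) \<in> parcs D \<longleftrightarrow> (v, u) \<notin> parcs D"
proof -
  obtain H where H: "pair_graph H" "split_partition H T S" "reflexive_orientation D H"
    using split_D unfolding transitive_split_orientation_def by blast
  interpret H: pair_graph H by fact
  have "(u, v) \<in> parcs H \<or> (v, u) \<in> parcs H"
    using assms H(2) unfolding split_partition_def by blast
  then show ?thesis using H(3) unfolding reflexive_orientation_def by blast
qed

lemma arc_trans:
  assumes "s \<in> T \<union> S" "u \<in> insert s T" "v \<in> insert s T" "w \<in> insert s T"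
    "(u, v) \<in> parcs D" "(v, w) \<in> parcs D"
  shows "(u, w) \<in> parcs D"
proof (cases "u = v \<or> v = w \<or> u = w")
  case True
  then show ?thesis using assms loops by auto
next
  case False
  have "trans_on (insert s T) (parcs D - Id)"
    using split_D assms(1) unfolding transitive_split_orientation_def induces_transitive_tournament_def
    by (auto simp: insert_absorb)
  from trans_onD[OF this assms(2-4)] False assms(5,6) show ?thesis by auto
qed

text \<open>By transitivity, an arc makes the in-neighbourhoods inside \<open>T\<close> nested.
  Without the arc from \<open>u\<close> to \<open>x\<close> the reverse arc is present, and that
  nesting is strict because the loop puts \<open>u\<close> into its own in-neighbourhood.\<close>

lemma arc_iff_level_le:
  assumes "u \<in> T" "x \<in> T \<union> S"
  shows "(u, x) \<in> parcs D \<longleftrightarrow> level u \<le> level x"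
proof
  assume "(u, x) \<in> parcs D"
  then have "{w \<in> T. (w, u) \<in> parcs D} \<subseteq> {w \<in> T. (w, x) \<in> parcs D}"
    using arc_trans[of x] assms by blast
  then show "level u \<le> level x"
    unfolding level_def using finite_T by (intro card_mono) auto
next
  assume le: "level u \<le> level x"
  show "(u, x) \<in> parcs D"
  proof (rule ccontr)
    assume n: "(u, x) \<notin> parcs D"
    then have "u \<noteq> x" using loops assms by blast
    then have "(x, u) \<in> parcs D" using arc_antisym assms n by blast
    then have "{w \<in> T. (w, x) \<in> parcs D} \<subset> {w \<in> T. (w, u) \<in> parcs D}"
      using arc_trans[of x _ x u] assms n loops by blast
    then have "level x < level u"
      unfolding level_def using finite_T by (intro psubset_card_mono) auto
    then show False using le by simp
  qed
qed

lemma arc_iff_level_less: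
  assumes "s \<in> S" "t \<in> T"
  shows "(s, t) \<in> parcs D \<longleftrightarrow> level s < level t"
  using arc_iff_level_le[of t s] arc_antisym[of t s] assms verts(2) by auto

lemma level_inj: "inj_on level T"
proof (rule inj_onI)
  fix u v assume "u \<in> T" "v \<in> T" "level u = level v"
  then show "u = v"
    using arc_iff_level_le[of u v] arc_iff_level_le[of v u] arc_antisym[of u v] by auto
qed

lemma level_le: "level x \<le> card T"
  unfolding level_def using finite_T by (intro card_mono) auto

text \<open>Distinct values in a range of the same size fill it. This is the source of the clique
  vertices at prescribed positions in later constructions.\<close>

lemma level_image: "level ` T = {1..card T}"
proof (rule card_subset_eq)
  have "level t > 0" if "t \<in> T" for t
    unfolding level_def using that loops finite_T by (auto simp: card_gt_0_iff)
  then show "level ` T \<subseteq> {1..card T}"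
    using level_le by (auto simp: Suc_le_eq)
  show "card (level ` T) = card {1..card T}"
    using level_inj by (simp add: card_image)
qed simp

lemma level_obtain:
  assumes "1 \<le> k" "k \<le> card T"
  obtains t where "t \<in> T" "level t = k"
  using assms level_image by (metis atLeastAtMost_iff imageE)

lemma topological_ordering_exists:
  assumes "X \<subseteq> T"
  shows "\<exists>ts. topological_ordering D X ts"
proof -
  obtain us where us: "set us = X" "distinct us"
    using finite_distinct_list[of X] assms finite_T finite_subset by blast
  have "sorted_wrt (\<lambda>u v. level u \<le> level v) (sort_key level us)"
    using sorted_sort_key[of level us] by (simp add: sorted_wrt_map)
  then have "sorted_wrt (\<lambda>u v. (u, v) \<in> parcs D) (sort_key level us)"
    by (rule sorted_wrt_mono_rel[rotated]) (use us assms arc_iff_level_le in auto)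
  then show ?thesis
    unfolding topological_ordering_def using us by (intro exI[of _ "sort_key level us"]) auto
qed

text \<open>The ordering inside \<open>in_level\<close> is existential. A suitable one lists the
  in-neighbours of \<open>s\<close> and then its out-neighbours; transitivity through
  \<open>s\<close> makes the concatenation topological.\<close>

lemma in_level_iff:
  assumes "s \<in> S"
  shows "in_level D T i s \<longleftrightarrow> level s = i"
proof
  assume "in_level D T i s"
  then show "level s = i"
    unfolding in_level_def topological_ordering_def level_def by (auto simp: distinct_card)
next
  assume i: "level s = i"
  let ?I = "{u \<in> T. (u, s) \<in> parcs D}" and ?O = "{u \<in> T. (s, u) \<in> parcs D}"
  obtain xs ys where xs: "topological_ordering D ?I xs" and ys: "topological_ordering D ?O ys"
    using topological_ordering_exists[of ?I] topological_ordering_exists[of ?O] by auto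
  have len: "length xs = i"
    using xs i unfolding topological_ordering_def level_def by (metis distinct_card)
  have IO: "?I \<union> ?O = T" "?I \<inter> ?O = {}"
    using arc_antisym[of _ s] assms verts(2) by auto
  have sets: "set xs = ?I" "set ys = ?O"
    using xs ys unfolding topological_ordering_def by simp_all
  have "(u, v) \<in> parcs D" if "u \<in> ?I" "v \<in> ?O" for u v
    using that arc_trans[of s u s v] assms by simp
  then have "sorted_wrt (\<lambda>u v. (u, v) \<in> parcs D) (xs @ ys)"
    using xs ys unfolding sorted_wrt_append sets topological_ordering_def by simp
  moreover have "distinct (xs @ ys)" "set (xs @ ys) = T"
    using xs ys IO sets unfolding topological_ordering_def by simp_all
  ultimately have ts: "topological_ordering D T (xs @ ys)"
    unfolding topological_ordering_def by blast
  then show "in_level D T i s"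
    unfolding in_level_def using len sets by (intro exI[of _ "xs @ ys"]) simp
qed

text \<open>The vertex \<open>z\<close> is neither required to lie in \<open>S\<close> nor to be a
  genuine exception, so the case without exceptions is included.\<close>

definition two_levels_but_one :: bool where
  "two_levels_but_one \<longleftrightarrow> (\<exists>i z. \<forall>s\<in>S. s \<noteq> z \<longrightarrow> level s = i \<or> level s = i + 1)"

lemma two_levels_but_one_iff:
  "two_levels_but_one \<longleftrightarrow>
     (\<exists>i. card {s \<in> S. \<not> (in_level D T i s \<or> in_level D T (i + 1) s)} \<le> 1)"
proof -
  have eq: "{s \<in> S. \<not> (in_level D T i s \<or> in_level D T (i + 1) s)} = {s \<in> S. level s \<noteq> i \<and> level s \<noteq> i + 1}" for i
    using in_level_iff by blast
  have "card {s \<in> S. level s \<noteq> i \<and> level s \<noteq> i + 1} \<le> 1 \<longleftrightarrow>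
      (\<exists>z. \<forall>s\<in>S. s \<noteq> z \<longrightarrow> level s = i \<or> level s = i + 1)" (is "card ?X \<le> 1 \<longleftrightarrow> _") for i
  proof
    assume "card ?X \<le> 1"
    then have "\<forall>u\<in>?X. \<forall>v\<in>?X. u = v" using finite_S by (auto simp: card_le_Suc0_iff_eq)
    then show "\<exists>z. \<forall>s\<in>S. s \<noteq> z \<longrightarrow> level s = i \<or> level s = i + 1"
      by blast
  next
    assume "\<exists>z. \<forall>s\<in>S. s \<noteq> z \<longrightarrow> level s = i \<or> level s = i + 1"
    then obtain z where "?X \<subseteq> {z}" by blast
    then show "card ?X \<le> 1" using card_mono[of "{z}" ?X] by simp
  qed
  then show ?thesis unfolding two_levels_but_one_def eq by blast
qed

lemma two_levels_imp_strongly_chordal: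
  assumes two_levels_but_one
  shows "strongly_chordal D"
proof -
  obtain i z where z: "\<And>s. \<lbrakk>s \<in> S; s \<noteq> z\<rbrakk> \<Longrightarrow> level s = i \<or> level s = i + 1"
    using assms unfolding two_levels_but_one_def by blast
  let ?l = "\<lambda>x. int (level x)"
  have "\<exists>r. gamma_free_rank (parcs D) (pverts D) r"
  proof (cases "level z < i + 1")
    case True
    \<comment> \<open>Here the upper value is \<open>w = i + 1\<close>.\<close>
    show ?thesis
    proof (rule gamma_free_rank_exists[OF pair_finite_verts verts])
      show "inj_on ?l T" using level_inj by (simp add: inj_on_def)
      show "?l z < int i + 1" using True by simp
      show "?l s = int i + 1 - 1 \<or> ?l s = int i + 1" if "s \<in> S" "s \<noteq> z" for s
        using z[OF that] by auto
    qed (simp_all add: arc_iff_level_le arc_iff_level_less arc_SS)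
  next
    case False
    txt \<open>Reversing all arcs negates the order of the clique, and moves the exceptional level below the others.\<close>
    have "\<exists>r. gamma_free_rank ((parcs D)\<inverse>) (pverts D) r"
    proof (rule gamma_free_rank_exists[OF pair_finite_verts verts])
      show "inj_on (\<lambda>x. - ?l x) T" using level_inj by (simp add: inj_on_def)
      \<comment> \<open>The extra \<open>- 1\<close> in the reversed level compensates for clique
        arcs into \<open>S\<close> being decided by a weak and arcs out of \<open>S\<close> by a
        strict inequality. Levels \<open>i\<close> and \<open>i + 1\<close> become \<open>w\<close>
        and \<open>w - 1\<close> for \<open>w = - i - 1\<close>.\<close>
      show "- ?l z - 1 < - int i - 1" using False by simp
      show "- ?l s - 1 = - int i - 1 - 1 \<or> - ?l s - 1 = - int i - 1" if "s \<in> S" "s \<noteq> z" for s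
        using z[OF that] by auto
    qed (auto simp: arc_iff_level_le arc_iff_level_less arc_SS)
    then show ?thesis unfolding gamma_free_rank_converse .
  qed
  then show ?thesis using strongly_chordal_iff_rank pair_finite_verts by blast
qed

end

section \<open>From a strong ordering to two consecutive levels\<close>

lemma (in split_orientation) strongly_chordal_imp_two_levels:
  assumes "strongly_chordal D"
  shows two_levels_but_one
proof (cases "S = {} \<or> T = {}")
  case True
  \<comment> \<open>With an empty clique every level is 0.\<close>
  then show ?thesis
    unfolding two_levels_but_one_def using level_le by fastforce
next
  case False
  obtain r where r: "gamma_free_rank (parcs D) (pverts D) r"
    using assms strongly_chordal_iff_rank[OF pair_finite_verts] by blast
  note G = gamma_free_rankD[OF r]
  have rinj: "r u \<noteq> r v" if "u \<in> pverts D" "v \<in> pverts D" "u \<noteq> v" for u v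
    using r that unfolding gamma_free_rank_def inj_on_def by blast
  obtain z where z: "z \<in> S" "\<And>s. s \<in> S \<Longrightarrow> r s \<le> r z"
    using finite_obtain_max[OF finite_S, of r] False by blast
  obtain w where w: "w \<in> T" "\<And>t. t \<in> T \<Longrightarrow> r w \<le> r t"
    using finite_obtain_min[OF finite_T, of r] False by blast
  have lw: "level w \<ge> 1" "level w \<le> card T" using w(1) level_image by force+
  have wmin: "r w < r t" if "t \<in> T" "t \<noteq> w" for t
    using w(2)[OF that(1)] rinj[of w t] w(1) that verts by auto
  txt \<open>
    All of \<open>S\<close> but its last vertex precedes \<open>T\<close>; this forces \<open>r\<close> to decrease along the in-neighbours
    and to increase along the out-neighbours of such a vertex, so that its level is
    \<open>level w\<close> or one less.
  \<close>
  have first: "r s < r t" if "s \<in> S" "s \<noteq> z" "t \<in> T" for s t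
  proof -
    have "r s < r t \<or> r z < r t"
    proof (rule gamma_free_rank_nonadjacent[OF r])
      show "(s, z) \<notin> parcs D" "(z, s) \<notin> parcs D" using arc_SS that z(1) by auto
      show "(s, t) \<in> parcs D \<or> (t, s) \<in> parcs D" "(z, t) \<in> parcs D \<or> (t, z) \<in> parcs D"
        using that z(1) by (auto simp: arc_iff_level_le arc_iff_level_less)
    qed (use that z(1) verts loops in auto)
    then show ?thesis using z(2)[OF that(1)] by auto
  qed
  have "level s = level w - 1 \<or> level s = level w - 1 + 1" if s: "s \<in> S" "s \<noteq> z" for s
  proof (rule ccontr)
    assume n: "\<not> ?thesis"
    then consider "level s + 1 < level w" | "level w + 1 \<le> level s" using lw by linarith
    then show False
    proof cases
      case 1
      \<comment> \<open>An out-neighbour \<open>t\<close> of \<open>s\<close> that precedes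
        \<open>w\<close> topologically: rows \<open>s\<close>, \<open>w\<close> and columns
        \<open>w\<close>, \<open>t\<close>, with the loop at \<open>w\<close>, give the forbidden
        pattern.\<close>
      obtain t where t: "t \<in> T" "level t = level s + 1"
        using level_obtain[of "level s + 1"] 1 lw by auto
      have "t \<noteq> w" using t 1 by auto
      with t have "r w < r t" using wmin by blast
      moreover have "r s < r w" using first s w(1) by blast
      ultimately show False
        using G[of s w w t] s(1) t w(1) 1 verts(1) by (simp add: arc_iff_level_le arc_iff_level_less)
    next
      case 2
      \<comment> \<open>Dually, an in-neighbour \<open>t\<close> of \<open>s\<close> behind
        \<open>w\<close> topologically: rows \<open>w\<close>, \<open>t\<close> and columns
        \<open>s\<close>, \<open>w\<close>.\<close>
      obtain t where t: "t \<in> T" "level t = level w + 1"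
        using level_obtain[of "level w + 1"] 2 level_le[of s] by auto
      have "t \<noteq> w" using t by auto
      with t have "r w < r t" using wmin by blast
      moreover have "r s < r w" using first s w(1) by blast
      ultimately show False
        using G[of w t s w] s(1) t w(1) 2 verts(1) by (simp add: arc_iff_level_le arc_iff_level_less)
    qed
  qed
  then show ?thesis unfolding two_levels_but_one_def by blast
qed

section \<open>Recovering the split partition and its transitivity\<close>

lemma strongly_chordal_imp_split_orientation:
  assumes D: "pair_fin_digraph D" "reflexive_multipartite_tournament D" "strongly_chordal D"
  shows "\<exists>T S. transitive_split_orientation D T S"
proof -
  interpret pair_fin_digraph D by fact
  obtain r where r: "gamma_free_rank (parcs D) (pverts D) r"
    using assms strongly_chordal_iff_rank[OF pair_finite_verts] by blast
  have rinj: "r u \<noteq> r v" if "u \<in> pverts D" "v \<in> pverts D" "u \<noteq> v" for u v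
    using r that unfolding gamma_free_rank_def inj_on_def by blast
  obtain H where "complete_multipartite H" and ori: "reflexive_orientation D H"
    using D(2) unfolding reflexive_multipartite_tournament_def by blast
  then obtain P where H: "pair_graph H" and P: "partition_on (pverts H) P"
    and AH: "parcs H = {(u, v). \<exists>A\<in>P. \<exists>B\<in>P. A \<noteq> B \<and> u \<in> A \<and> v \<in> B}"
    unfolding complete_multipartite_def by blast
  have V: "pverts H = pverts D" using ori unfolding reflexive_orientation_def by simp
  have loops: "(x, x) \<in> parcs D" if "x \<in> pverts D" for x
    using ori that V unfolding reflexive_orientation_def by (auto simp: Id_on_iff)
  have one: "(u, v) \<in> parcs D \<longleftrightarrow> (v, u) \<notin> parcs D" if "(u, v) \<in> parcs H" for u v
    using ori that unfolding reflexive_orientation_def by blast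
  have none: "(u, v) \<notin> parcs D" if "(u, v) \<notin> parcs H" "u \<noteq> v" for u v
    using ori that unfolding reflexive_orientation_def by auto
  have sym: "(v, u) \<in> parcs H" if "(u, v) \<in> parcs H" for u v
    using that unfolding AH by blast
  have irr: "(u, u) \<notin> parcs H" for u
  proof
    assume "(u, u) \<in> parcs H"
    then show False using one[of u u] by blast
  qed
  have part: "\<exists>A\<in>P. u \<in> A" if "u \<in> pverts D" for u
    using P that V unfolding partition_on_def by auto
  have ntrans: "(u, w) \<notin> parcs H" if "(u, v) \<notin> parcs H" "(v, w) \<notin> parcs H" "v \<in> pverts D" for u v w
    using that part[of v] unfolding AH by blast
  \<comment> \<open>Nonadjacency means lying in one part, so the four vertices form a 4-cycle in
    \<open>H\<close>. Its first vertex would precede both of its neighbours, which are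
    nonadjacent.\<close>
  have no_C4: False
    if "a \<in> pverts D" "b \<in> pverts D" "c \<in> pverts D" "d \<in> pverts D" "a \<noteq> b" "c \<noteq> d"
      "(a, b) \<notin> parcs H" "(c, d) \<notin> parcs H" "(a, c) \<in> parcs H" for a b c d
  proof -
    have ad: "(a, d) \<in> parcs H" using ntrans[of a d c] that sym by blast
    have bc: "(b, c) \<in> parcs H" using ntrans[of a b c] that sym by blast
    have bd: "(b, d) \<in> parcs H" using ntrans[of a b d] that ad by blast
    have key: "r u < r x \<or> r v < r x"
      if "u \<in> pverts D" "v \<in> pverts D" "x \<in> pverts D" "u \<noteq> v" "(u, v) \<notin> parcs H"
        "(u, x) \<in> parcs H" "(v, x) \<in> parcs H" for u v x
    proof (rule gamma_free_rank_nonadjacent[OF r])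
      show "(u, v) \<notin> parcs D" "(v, u) \<notin> parcs D" using that none sym by blast+
      show "(u, x) \<in> parcs D \<or> (x, u) \<in> parcs D" "(v, x) \<in> parcs D \<or> (x, v) \<in> parcs D"
        using that one by blast+
    qed (use that loops in auto)
    show False
      using key[of a b c] key[of a b d] key[of c d a] key[of c d b] that ad bc bd
        sym[of a c] sym[of a d] sym[of b c] sym[of b d] by force
  qed
  \<comment> \<open>The union of the parts with at least two vertices. By \<open>no_C4\<close> there
    is at most one such part, so \<open>S\<close> is independent.\<close>
  define S where "S = {u \<in> pverts D. \<exists>v\<in>pverts D. v \<noteq> u \<and> (u, v) \<notin> parcs H}"
  define T where "T = pverts D - S"
  have clique: "(u, v) \<in> parcs H" if "u \<in> T" "v \<in> pverts D" "u \<noteq> v" for u v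
    using that unfolding T_def S_def by auto
  have "split_partition H T S"
    unfolding split_partition_def
  proof (intro conjI ballI impI)
    show "T \<union> S = pverts H" "T \<inter> S = {}" unfolding V T_def S_def by blast+
    show "(u, v) \<in> parcs H" if "u \<in> T" "v \<in> T" "u \<noteq> v" for u v
      using clique that T_def by blast
    show "(s, t) \<in> parcs H" if "s \<in> S" "t \<in> T" for s t
      using clique[of t s] sym that T_def S_def by blast
    show "(u, v) \<notin> parcs H" if "u \<in> S" "v \<in> S" for u v
      using that no_C4 unfolding S_def by blast
  qed
  moreover have tour: "induces_transitive_tournament D X"
    if X: "X \<subseteq> pverts D" "\<And>u v. u \<in> X \<Longrightarrow> v \<in> X \<Longrightarrow> u \<noteq> v \<Longrightarrow> (u, v) \<in> parcs H" for X
    unfolding induces_transitive_tournament_def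
  proof (intro conjI)
    show "total_on X (parcs D - Id)" using X one unfolding total_on_def by blast
    show "asym_on X (parcs D - Id)" using X one unfolding asym_on_def by blast
    show "trans_on X (parcs D - Id)"
    proof (rule trans_onI)
      fix u v w assume X': "u \<in> X" "v \<in> X" "w \<in> X" and uv: "(u, v) \<in> parcs D - Id" and vw: "(v, w) \<in> parcs D - Id"
      then have "u \<noteq> w" using X one[of u v] by blast
      moreover have "(u, w) \<in> parcs D"
      proof (rule ccontr)
        assume "(u, w) \<notin> parcs D"
        then have wu: "(w, u) \<in> parcs D" using X X' one[of w u] \<open>u \<noteq> w\<close> by blast
        have V': "u \<in> pverts D" "v \<in> pverts D" "w \<in> pverts D" using X X' by blast+
        have d: "u \<noteq> v" "v \<noteq> w" using uv vw by auto
        have "r u \<noteq> r v" "r v \<noteq> r w" "r u \<noteq> r w" using rinj V' d \<open>u \<noteq> w\<close> by blast+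
        \<comment> \<open>Bypassing the first vertex of the directed triangle gives an arc opposite
          to one of its arcs.\<close>
        then consider "r u < r v" "r u < r w" | "r v < r u" "r v < r w" | "r w < r u" "r w < r v"
          by linarith
        then show False
        proof cases
          case 1
          then have "(w, v) \<in> parcs D" using gamma_free_rank_bypass[OF r, of u w v] V' loops wu uv by blast
          then show False using vw one[of v w] X X' d by blast
        next
          case 2
          then have "(u, w) \<in> parcs D" using gamma_free_rank_bypass[OF r, of v u w] V' loops vw uv by blast
          then show False using \<open>(u, w) \<notin> parcs D\<close> by blast
        next
          case 3
          then have "(v, u) \<in> parcs D" using gamma_free_rank_bypass[OF r, of w v u] V' loops vw wu by blast
          then show False using uv one[of u v] X X' d by blast
        qed
      qed
      ultimately show "(u, w) \<in> parcs D - Id" by simp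
    qed
  qed
  moreover have "induces_transitive_tournament D T"
    using clique by (intro tour) (auto simp: T_def)
  moreover have "induces_transitive_tournament D (insert s T)" if "s \<in> S" for s
  proof (rule tour)
    show "insert s T \<subseteq> pverts D" using that unfolding T_def S_def by blast
    show "(u, v) \<in> parcs H" if "u \<in> insert s T" "v \<in> insert s T" "u \<noteq> v" for u v
      using that \<open>s \<in> S\<close> clique[of u v] clique[of v u] sym[of v u] unfolding T_def S_def by blast
  qed
  ultimately show ?thesis unfolding transitive_split_orientation_def using H ori by blast
qed

section \<open>The forbidden subdigraphs\<close>

definition embeds :: "'b pair_pre_digraph \<Rightarrow> 'a pair_pre_digraph \<Rightarrow> ('b \<Rightarrow> 'a) \<Rightarrow> bool" where
  "embeds F D g \<longleftrightarrow> inj_on g (pverts F) \<and> g ` pverts F \<subseteq> pverts D \<and>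
     (\<forall>x\<in>pverts F. \<forall>y\<in>pverts F. (x, y) \<in> parcs F \<longleftrightarrow> (g x, g y) \<in> parcs D)"

text \<open>A digraph isomorphism carries a separate map on arcs. As arcs are pairs, compatibility
  with tails and heads forces it to act as the vertex map on both coordinates, so only the vertex
  map matters.\<close>

lemma induced_iso_iff_embeds:
  assumes "pair_wf_digraph D" "pair_wf_digraph F"
  shows "(\<exists>X\<subseteq>pverts D. digraph_iso (with_proj D \<restriction> X) (with_proj F)) \<longleftrightarrow> (\<exists>g. embeds F D g)"
proof
  interpret D: pair_wf_digraph D by fact
  interpret F: pair_wf_digraph F by fact
  {
    assume "\<exists>X\<subseteq>pverts D. digraph_iso (with_proj D \<restriction> X) (with_proj F)"
    then obtain X f where X: "X \<subseteq> pverts D"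
      and f: "pre_digraph.digraph_isomorphism (with_proj D \<restriction> X) f"
      and F: "with_proj F = app_iso f (with_proj D \<restriction> X)"
      unfolding digraph_iso_def by blast
    let ?v = "iso_verts f" and ?a = "iso_arcs f"
    let ?A = "{e \<in> parcs D. fst e \<in> X \<and> snd e \<in> X}"
    have inj: "inj_on ?v X"
      using f unfolding pre_digraph.digraph_isomorphism_def by simp
    have sel: "fst = iso_tail f" "snd = iso_head f" "pverts F = ?v ` X" "parcs F = ?a ` ?A"
      using arg_cong[OF F, of tail] arg_cong[OF F, of head] arg_cong[OF F, of verts]
        arg_cong[OF F, of arcs] by simp_all
    have "?a e = (?v (fst e), ?v (snd e))" if "e \<in> ?A" for e
    proof -
      have "?v (fst e) = fst (?a e)" "?v (snd e) = snd (?a e)"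
        using f that unfolding pre_digraph.digraph_isomorphism_def sel(1,2)[symmetric]
        by (cases e; simp)+
      then show ?thesis by simp
    qed
    then have arcsF: "parcs F = (\<lambda>e. (?v (fst e), ?v (snd e))) ` ?A"
      unfolding sel(4) by (auto intro: image_cong)
    \<comment> \<open>The isomorphism runs from the induced subdigraph to \<open>F\<close>, the
      embedding the other way.\<close>
    let ?g = "inv_into X ?v"
    have g: "?g (?v x) = x" if "x \<in> X" for x using inj that by simp
    have "embeds F D ?g"
      unfolding embeds_def
    proof (intro conjI ballI)
      show "inj_on ?g (pverts F)" unfolding sel(3) by (rule inj_on_inv_into) simp
      show "?g ` pverts F \<subseteq> pverts D" using X g unfolding sel(3) by auto
      fix x y assume "x \<in> pverts F" "y \<in> pverts F"
      then obtain x' y' where xy: "x' \<in> X" "y' \<in> X" "x = ?v x'" "y = ?v y'" unfolding sel(3) by blast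
      have "(x, y) \<in> parcs F \<longleftrightarrow> (x', y') \<in> parcs D"
      proof
        assume "(x, y) \<in> parcs F"
        then obtain e where "e \<in> ?A" "?v x' = ?v (fst e)" "?v y' = ?v (snd e)"
          unfolding arcsF xy by blast
        then have "x' = fst e" "y' = snd e" "e \<in> parcs D"
          using inj_onD[OF inj, of x' "fst e"] inj_onD[OF inj, of y' "snd e"] xy by auto
        then show "(x', y') \<in> parcs D" by simp
      next
        assume "(x', y') \<in> parcs D"
        then show "(x, y) \<in> parcs F" unfolding arcsF using xy by force
      qed
      then show "(x, y) \<in> parcs F \<longleftrightarrow> (?g x, ?g y) \<in> parcs D" using g xy by simp
    qed
    then show "\<exists>g. embeds F D g" by blast
  }
  {
    assume "\<exists>g. embeds F D g"
    then obtain g where inj: "inj_on g (pverts F)" and X: "g ` pverts F \<subseteq> pverts D"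
      and arcs: "\<And>x y. x \<in> pverts F \<Longrightarrow> y \<in> pverts F \<Longrightarrow> (x, y) \<in> parcs F \<longleftrightarrow> (g x, g y) \<in> parcs D"
      unfolding embeds_def by blast
    let ?h = "inv_into (pverts F) g"
    let ?f = "\<lparr> iso_verts = ?h, iso_arcs = map_prod ?h ?h, iso_head = snd, iso_tail = fst \<rparr>"
    let ?G = "with_proj D \<restriction> (g ` pverts F)"
    have h: "?h (g x) = x" if "x \<in> pverts F" for x using inj that by simp
    have injh: "inj_on ?h (g ` pverts F)" by (rule inj_on_inv_into) simp
    have arcsG: "arcs ?G = map_prod g g ` parcs F"
    proof (intro equalityI subsetI)
      fix e assume "e \<in> arcs ?G"
      then obtain x y where "x \<in> pverts F" "y \<in> pverts F" "e = (g x, g y)" "e \<in> parcs D"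
        by (cases e) auto
      then show "e \<in> map_prod g g ` parcs F" using arcs[of x y] by force
    next
      fix e assume "e \<in> map_prod g g ` parcs F"
      then obtain x y where "(x, y) \<in> parcs F" "e = (g x, g y)" by auto
      then show "e \<in> arcs ?G" using arcs[of x y] F.wellformed' by auto
    qed
    have hg: "map_prod ?h ?h (map_prod g g e) = e" if "e \<in> parcs F" for e
      using that h F.wellformed' by (cases e) auto
    have inja: "inj_on (map_prod ?h ?h) (arcs ?G)"
    proof (rule inj_on_inverseI)
      fix x assume "x \<in> arcs ?G"
      then have "x \<in> map_prod g g ` parcs F" by (simp only: arcsG)
      then obtain e where "x = map_prod g g e" "e \<in> parcs F" by (rule imageE)
      then show "map_prod g g (map_prod ?h ?h x) = x" by (simp only: hg)
    qed
    have "wf_digraph ?G" by (rule D.wellformed_induce_subgraph)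
    then have "pre_digraph.digraph_isomorphism ?G ?f"
      unfolding pre_digraph.digraph_isomorphism_def using injh inja by simp
    moreover have "with_proj F = app_iso ?f ?G"
    proof (rule pre_digraph.equality)
      show "verts (with_proj F) = verts (app_iso ?f ?G)"
        using h by (simp add: image_image)
      have "map_prod ?h ?h ` map_prod g g ` parcs F = parcs F"
        using hg by (simp add: image_image del: map_prod_simp)
      then show "arcs (with_proj F) = arcs (app_iso ?f ?G)"
        unfolding arcs_app_iso arcsG by simp
    qed simp_all
    ultimately show "\<exists>X\<subseteq>pverts D. digraph_iso (with_proj D \<restriction> X) (with_proj F)"
      unfolding digraph_iso_def using X by blast
  }
qed

lemma T_seq_verts:
  "Inl p \<in> pverts (T_seq c) \<longleftrightarrow> 1 \<le> p \<and> p < length c"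
  "Inr ik \<in> pverts (T_seq c) \<longleftrightarrow> fst ik < length c \<and> snd ik < c ! fst ik"
  by (cases ik; auto simp: T_seq_def Let_def)+

lemma T_seq_arcs:
  "(Inl p, Inl q) \<in> parcs (T_seq c) \<longleftrightarrow> 1 \<le> p \<and> q < length c \<and> p \<le> q"
  "(Inl p, Inr ik) \<in> parcs (T_seq c) \<longleftrightarrow> 1 \<le> p \<and> p \<le> fst ik \<and> fst ik < length c \<and> snd ik < c ! fst ik"
  "(Inr ik, Inl p) \<in> parcs (T_seq c) \<longleftrightarrow> fst ik < p \<and> p < length c \<and> snd ik < c ! fst ik"
  "(Inr ik, Inr jl) \<in> parcs (T_seq c) \<longleftrightarrow> ik = jl \<and> fst ik < length c \<and> snd ik < c ! fst ik"
  by (cases ik; cases jl; auto simp: T_seq_def Let_def Id_on_iff)+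

lemma T_seq_wf: "pair_wf_digraph (T_seq c)"
proof
  fix e assume e: "e \<in> parcs (T_seq c)"
  have "fst e \<in> pverts (T_seq c) \<and> snd e \<in> pverts (T_seq c)"
    using e by (cases e; cases "fst e"; cases "snd e") (auto simp: T_seq_verts T_seq_arcs)
  then show "fst e \<in> pverts (T_seq c)" "snd e \<in> pverts (T_seq c)" by auto
qed

context split_orientation
begin

lemma F_r_free_iff:
  "F_r_free D \<longleftrightarrow> (\<forall>F\<in>F_r. \<not> (\<exists>g. embeds F D g))"
proof -
  have "pair_wf_digraph F" if "F \<in> F_r" for F
    using that T_seq_wf unfolding F_r_def by blast
  then show ?thesis
    unfolding F_r_free_def
    by (simp add: induced_iso_iff_embeds[OF pair_wf_digraph_axioms] cong: ball_cong)
qed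

text \<open>Arcs depend only on how levels compare, so the levels in \<open>D\<close> need not equal
  those of the pattern; only their order relative to the chosen clique vertices counts.\<close>

lemma embeds_T_seqI:
  assumes t: "\<And>p. \<lbrakk>1 \<le> p; p < length c\<rbrakk> \<Longrightarrow> t p \<in> T"
    and mono: "\<And>p q. \<lbrakk>1 \<le> p; p < q; q < length c\<rbrakk> \<Longrightarrow> level (t p) < level (t q)"
    and s: "\<And>i k. \<lbrakk>i < length c; k < c ! i\<rbrakk> \<Longrightarrow> s (i, k) \<in> S"
    and inj: "inj_on s {(i, k). i < length c \<and> k < c ! i}"
    and lev: "\<And>i k p. \<lbrakk>i < length c; k < c ! i; 1 \<le> p; p < length c\<rbrakk>
      \<Longrightarrow> level (t p) \<le> level (s (i, k)) \<longleftrightarrow> p \<le> i"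
  shows "embeds (T_seq c) D (case_sum t s)"
proof -
  have t_inj: "t p = t q \<longleftrightarrow> p = q" if "1 \<le> p" "p < length c" "1 \<le> q" "q < length c" for p q
    using mono[of p q] mono[of q p] that by (cases p q rule: linorder_cases) auto
  have t_le: "level (t p) \<le> level (t q) \<longleftrightarrow> p \<le> q" if "1 \<le> p" "p < length c" "1 \<le> q" "q < length c" for p q
    using mono[of p q] mono[of q p] that by (cases p q rule: linorder_cases) auto
  have s_inj: "s ik = s jl \<longleftrightarrow> ik = jl"
    if "fst ik < length c" "snd ik < c ! fst ik" "fst jl < length c" "snd jl < c ! fst jl" for ik jl
    using inj_onD[OF inj, of ik jl] that by (auto simp: case_prod_beta)
  have ts: "t p \<noteq> s ik" if "1 \<le> p" "p < length c" "fst ik < length c" "snd ik < c ! fst ik" for p ik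
    using t[of p] s[of "fst ik" "snd ik"] that verts(2) by auto
  have s': "s ik \<in> S" if "fst ik < length c" "snd ik < c ! fst ik" for ik
    using s[of "fst ik" "snd ik"] that by simp
  have lev': "level (t p) \<le> level (s ik) \<longleftrightarrow> p \<le> fst ik"
    if "fst ik < length c" "snd ik < c ! fst ik" "1 \<le> p" "p < length c" for p ik
    using lev[of "fst ik" "snd ik" p] that by simp
  show ?thesis
    unfolding embeds_def
  proof (intro conjI ballI)
    show "inj_on (case_sum t s) (pverts (T_seq c))"
    proof (rule inj_onI)
      fix x y assume "x \<in> pverts (T_seq c)" "y \<in> pverts (T_seq c)" "case_sum t s x = case_sum t s y"
      then show "x = y"
        by (cases x; cases y) (simp_all add: T_seq_verts t_inj s_inj ts ts[symmetric])
    qed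
    show "case_sum t s ` pverts (T_seq c) \<subseteq> pverts D"
    proof clarify
      fix x assume "x \<in> pverts (T_seq c)"
      then show "case_sum t s x \<in> pverts D"
        using t s' verts by (cases x) (auto simp: T_seq_verts)
    qed
    fix x y assume "x \<in> pverts (T_seq c)" "y \<in> pverts (T_seq c)"
    then show "(x, y) \<in> parcs (T_seq c) \<longleftrightarrow> (case_sum t s x, case_sum t s y) \<in> parcs D"
      by (cases x; cases y)
        (auto simp: T_seq_verts T_seq_arcs t s' arc_iff_level_le arc_iff_level_less arc_SS t_le lev' s_inj
          not_le[symmetric])
  qed
qed

text \<open>Two occupied levels give each independent vertex of the pattern a nonadjacent partner,
  which forces its image into \<open>S\<close>. A clique vertex of the pattern is adjacent to such
  an image and so lands in \<open>T\<close>.\<close>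

lemma embeds_T_seqD:
  assumes g: "embeds (T_seq c) D g"
    and two: "i0 < length c" "0 < c ! i0" "j0 < length c" "0 < c ! j0" "i0 \<noteq> j0"
  shows "\<lbrakk>i < length c; k < c ! i\<rbrakk> \<Longrightarrow> g (Inr (i, k)) \<in> S"
    and "\<lbrakk>1 \<le> p; p < length c\<rbrakk> \<Longrightarrow> g (Inl p) \<in> T"
    and "\<lbrakk>i < length c; k < c ! i; i < p; p < length c\<rbrakk> \<Longrightarrow> level (g (Inr (i, k))) < level (g (Inl p))"
    and "\<lbrakk>i < length c; k < c ! i; 1 \<le> p; p \<le> i\<rbrakk> \<Longrightarrow> level (g (Inl p)) \<le> level (g (Inr (i, k)))"
    and "\<lbrakk>1 \<le> p; p < q; q < length c\<rbrakk> \<Longrightarrow> level (g (Inl p)) < level (g (Inl q))"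
proof -
  have inj: "g x = g y \<longleftrightarrow> x = y" if "x \<in> pverts (T_seq c)" "y \<in> pverts (T_seq c)" for x y
    using g that unfolding embeds_def inj_on_def by blast
  have V: "g x \<in> T \<union> S" if "x \<in> pverts (T_seq c)" for x
    using g that verts unfolding embeds_def by auto
  have arcs: "(x, y) \<in> parcs (T_seq c) \<longleftrightarrow> (g x, g y) \<in> parcs D"
    if "x \<in> pverts (T_seq c)" "y \<in> pverts (T_seq c)" for x y
    using g that unfolding embeds_def by blast
  show S: "g (Inr (i, k)) \<in> S" if "i < length c" "k < c ! i" for i k
  proof -
    obtain j where j: "j < length c" "0 < c ! j" "j \<noteq> i"
      using two by (cases "i = i0") auto
    have mem: "Inr (i, k) \<in> pverts (T_seq c)" "Inr (j, 0) \<in> pverts (T_seq c)"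
      using that j by (auto simp: T_seq_verts)
    have "(g (Inr (i, k)), g (Inr (j, 0))) \<notin> parcs D" "(g (Inr (j, 0)), g (Inr (i, k))) \<notin> parcs D"
      using arcs[OF mem] arcs[OF mem(2,1)] j by (auto simp: T_seq_arcs)
    then show ?thesis
      using arc_antisym[of "g (Inr (i, k))" "g (Inr (j, 0))"] V[OF mem(1)] V[OF mem(2)] inj[OF mem] j by auto
  qed
  show T: "g (Inl p) \<in> T" if "1 \<le> p" "p < length c" for p
  proof -
    have mem: "Inl p \<in> pverts (T_seq c)" "Inr (i0, 0) \<in> pverts (T_seq c)"
      using that two by (auto simp: T_seq_verts)
    have "(g (Inl p), g (Inr (i0, 0))) \<in> parcs D \<or> (g (Inr (i0, 0)), g (Inl p)) \<in> parcs D"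
      using arcs[OF mem] arcs[OF mem(2,1)] two that by (auto simp: T_seq_arcs)
    then show ?thesis
      using V[OF mem(1)] S[OF two(1,2)] arc_SS inj[OF mem] by fastforce
  qed
  show "level (g (Inr (i, k))) < level (g (Inl p))" if "i < length c" "k < c ! i" "i < p" "p < length c"
    using arcs[of "Inr (i, k)" "Inl p"] S[of i k] T[of p] that
    by (simp add: T_seq_verts T_seq_arcs arc_iff_level_less)
  show "level (g (Inl p)) \<le> level (g (Inr (i, k)))" if "i < length c" "k < c ! i" "1 \<le> p" "p \<le> i"
    using arcs[of "Inl p" "Inr (i, k)"] S[of i k] T[of p] that
    by (simp add: T_seq_verts T_seq_arcs arc_iff_level_le)
  show "level (g (Inl p)) < level (g (Inl q))" if "1 \<le> p" "p < q" "q < length c"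
    using arcs[of "Inl q" "Inl p"] T[of p] T[of q] that
    by (simp add: T_seq_verts T_seq_arcs arc_iff_level_le)
qed

end

section \<open>Extremal argument on the values of the levels\<close>

text \<open>Beyond two elements, split off a minimum \<open>l\<close> and then a maximum
  \<open>h\<close>, and let \<open>b\<close>, \<open>c\<close> be extremal among the rest.
  \<open>n202\<close> bounds \<open>f c - f b\<close> by 1. If neither \<open>l\<close> nor
  \<open>h\<close> can be the sole exception at once, \<open>n1111\<close> makes the middle values
  equal and \<open>n10101\<close> puts \<open>f l\<close> just below them, leaving \<open>h\<close>
  as the exception.\<close>

lemma two_values_but_one:
  fixes f :: "'a \<Rightarrow> nat"
  assumes fin: "finite S"
    and n202: "\<And>a b c d. \<lbrakk>a \<in> S; b \<in> S; c \<in> S; d \<in> S; a \<noteq> b; c \<noteq> d;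
      f a + 2 \<le> f c; f a + 2 \<le> f d; f b + 2 \<le> f c; f b + 2 \<le> f d\<rbrakk> \<Longrightarrow> False"
    and n1111: "\<And>a b c d. \<lbrakk>a \<in> S; b \<in> S; c \<in> S; d \<in> S; f a < f b; f b < f c; f c < f d\<rbrakk> \<Longrightarrow> False"
    and n10101: "\<And>a b c. \<lbrakk>a \<in> S; b \<in> S; c \<in> S; f a + 2 \<le> f b; f b + 2 \<le> f c\<rbrakk> \<Longrightarrow> False"
  shows "\<exists>i z. \<forall>s\<in>S. s \<noteq> z \<longrightarrow> f s = i \<or> f s = i + 1"
proof (cases "\<exists>l h. S \<subseteq> {l, h}")
  case True
  then show ?thesis by blast
next
  case False
  then have "S \<noteq> {}" by auto
  then obtain l where l: "l \<in> S" "\<And>s. s \<in> S \<Longrightarrow> f l \<le> f s"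
    using finite_obtain_min[OF fin, of f] by blast
  have "S - {l} \<noteq> {}" using False by blast
  then obtain h where "h \<in> S - {l}" "\<And>s. s \<in> S - {l} \<Longrightarrow> f s \<le> f h"
    using finite_obtain_max[of "S - {l}" f] fin by blast
  then have h: "h \<in> S" "h \<noteq> l" "\<And>s. s \<in> S \<Longrightarrow> s \<noteq> l \<Longrightarrow> f s \<le> f h"
    by simp_all
  have ne: "S - {l, h} \<noteq> {}" using False by blast
  then obtain b where b: "b \<in> S - {l, h}" "\<And>s. s \<in> S - {l, h} \<Longrightarrow> f b \<le> f s"
    using finite_obtain_min[of "S - {l, h}" f] fin by blast
  obtain c where c: "c \<in> S - {l, h}" "\<And>s. s \<in> S - {l, h} \<Longrightarrow> f s \<le> f c"
    using finite_obtain_max[of "S - {l, h}" f] fin ne by blast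
  have ord: "f l \<le> f b" "f b \<le> f c" "f c \<le> f h" using l h b c by auto
  have cb: "f c \<le> f b + 1"
    using n202[of l b c h] l(1) h(1) b(1) c(1) ord by fastforce
  have mid: "f s = f b \<or> f s = f c" if "s \<in> S" "s \<noteq> l" "s \<noteq> h" for s
    using b(2)[of s] c(2)[of s] cb that by force
  consider "f l = f b" | "f h \<le> f b + 1" | "f l < f b" "f h > f b + 1" using ord by linarith
  then show ?thesis
  proof cases
    case 1
    then show ?thesis using mid cb ord by (intro exI[of _ "f b"] exI[of _ h]) force
  next
    case 2
    then show ?thesis using mid cb ord by (intro exI[of _ "f b"] exI[of _ l]) force
  next
    case 3
    have "f c \<noteq> f b + 1" using n1111[of l b c h] l h b c 3 by auto
    then have "f c = f b" using cb ord by simp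
    moreover have "f l + 1 = f b" using n10101[of l b h] l h b 3 by fastforce
    ultimately show ?thesis using mid by (intro exI[of _ "f l"] exI[of _ h]) force
  qed
qed

section \<open>Forbidden subdigraphs against the level condition\<close>

context split_orientation
begin

text \<open>In the first pattern, one vertex other than \<open>z\<close> remains at each end, with
  levels at least 2 apart. In the others only the values \<open>level z\<close>, \<open>i\<close>,
  \<open>i + 1\<close> are available: too few for four distinct levels, and for three levels with
  gaps of 2.\<close>

lemma two_levels_imp_F_r_free:
  assumes two_levels_but_one
  shows "F_r_free D"
  unfolding F_r_free_iff
proof (intro ballI notI)
  fix F :: "(nat + nat \<times> nat) pair_pre_digraph"
  assume F: "F \<in> F_r" and "\<exists>g. embeds F D g"
  then obtain g where g: "embeds F D g" by blast
  obtain i z where z: "\<And>s. \<lbrakk>s \<in> S; s \<noteq> z\<rbrakk> \<Longrightarrow> level s = i \<or> level s = i + 1"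
    using assms unfolding two_levels_but_one_def by blast
  have inj: "g x \<noteq> g y" if "x \<in> pverts F" "y \<in> pverts F" "x \<noteq> y" for x y
    using g that unfolding embeds_def inj_on_def by blast
  let ?s = "\<lambda>i k. g (Inr (i, k))" and ?t = "\<lambda>p. g (Inl p)"
  from F consider "F = T_seq [2, 0, 2]" | "F = T_seq [1, 1, 1, 1]" | "F = T_seq [1, 0, 1, 0, 1]"
    unfolding F_r_def by blast
  then show False
  proof cases
    case 1
    note E = embeds_T_seqD[OF g[unfolded 1], of 0 2, simplified]
    have S: "?s 0 0 \<in> S" "?s 0 1 \<in> S" "?s 2 0 \<in> S" "?s 2 1 \<in> S"
      using E(1)[of 0 0] E(1)[of 0 1] E(1)[of 2 0] E(1)[of 2 1] by simp_all
    \<comment> \<open>The gap is 2 because both clique vertices lie between: the chain has two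
      strict steps and a final weak one.\<close>
    have "level (?s 0 k) + 2 \<le> level (?s 2 l)" if "k < 2" "l < 2" for k l
      using E(3)[of 0 k 1] E(5)[of 1 2] E(4)[of 2 l 2] that by simp
    note gap = this[of 0 0] this[of 0 1] this[of 1 0] this[of 1 1]
    have ne: "?s 0 0 \<noteq> ?s 0 1" "?s 2 0 \<noteq> ?s 2 1"
      by (rule inj; simp add: 1 T_seq_verts)+
    obtain x where x: "x = ?s 0 0 \<or> x = ?s 0 1" "x \<noteq> z" using ne(1) by blast
    obtain y where y: "y = ?s 2 0 \<or> y = ?s 2 1" "y \<noteq> z" using ne(2) by blast
    have "level x + 2 \<le> level y" using x(1) y(1) gap by auto
    then show False
      using z[of x] z[of y] x y S by auto
  next
    case 2
    note E = embeds_T_seqD[OF g[unfolded 2], of 0 1, simplified]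
    have S: "?s 0 0 \<in> S" "?s 1 0 \<in> S" "?s 2 0 \<in> S" "?s 3 0 \<in> S"
      using E(1)[of 0 0] E(1)[of 1 0] E(1)[of 2 0] E(1)[of 3 0] by simp_all
    have "level (?s 0 0) < level (?s 1 0)" "level (?s 1 0) < level (?s 2 0)" "level (?s 2 0) < level (?s 3 0)"
      using E(3)[of 0 0 1] E(4)[of 1 0 1] E(3)[of 1 0 2] E(4)[of 2 0 2] E(3)[of 2 0 3] E(4)[of 3 0 3]
      by simp_all
    moreover have "level s = level z \<or> level s = i \<or> level s = i + 1" if "s \<in> S" for s
      using z[OF that] by blast
    note this[OF S(1)] this[OF S(2)] this[OF S(3)] this[OF S(4)]
    ultimately show False by auto
  next
    case 3
    note E = embeds_T_seqD[OF g[unfolded 3], of 0 2, simplified]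
    have S: "?s 0 0 \<in> S" "?s 2 0 \<in> S" "?s 4 0 \<in> S"
      using E(1)[of 0 0] E(1)[of 2 0] E(1)[of 4 0] by simp_all
    have "level (?s 0 0) + 2 \<le> level (?s 2 0)" "level (?s 2 0) + 2 \<le> level (?s 4 0)"
      using E(3)[of 0 0 1] E(5)[of 1 2] E(4)[of 2 0 2] E(3)[of 2 0 3] E(5)[of 3 4] E(4)[of 4 0 4]
      by simp_all
    moreover have "level s = level z \<or> level s = i \<or> level s = i + 1" if "s \<in> S" for s
      using z[OF that] by blast
    note this[OF S(1)] this[OF S(2)] this[OF S(3)]
    ultimately show False by auto
  qed
qed

lemma F_r_free_imp_two_levels:
  assumes "F_r_free D"
  shows two_levels_but_one
  unfolding two_levels_but_one_def
proof (rule two_values_but_one[OF finite_S])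
  have free: "\<not> embeds (T_seq [2, 0, 2]) D g" "\<not> embeds (T_seq [1, 1, 1, 1]) D g"
    "\<not> embeds (T_seq [1, 0, 1, 0, 1]) D g" for g
    using assms unfolding F_r_free_iff F_r_def by blast+
  show False if S: "a \<in> S" "b \<in> S" "c \<in> S" "d \<in> S" and d: "a \<noteq> b" "c \<noteq> d"
    and lev: "level a + 2 \<le> level c" "level a + 2 \<le> level d"
      "level b + 2 \<le> level c" "level b + 2 \<le> level d" for a b c d
  proof -
    \<comment> \<open>Positions \<open>k + 1\<close> and \<open>k + 2\<close> exceed the levels of
      \<open>a\<close> and \<open>b\<close> and do not exceed those of \<open>c\<close> and
      \<open>d\<close>.\<close>
    define k where "k = max (level a) (level b)"
    have k: "level a \<le> k" "level b \<le> k" "k + 2 \<le> level c" "k + 2 \<le> level d"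
      using lev unfolding k_def by auto
    obtain t1 where t1: "t1 \<in> T" "level t1 = k + 1"
      using level_obtain[of "k + 1"] k level_le[of c] by auto
    obtain t2 where t2: "t2 \<in> T" "level t2 = k + 2"
      using level_obtain[of "k + 2"] k level_le[of c] by auto
    let ?c = "[2, 0, 2 :: nat]"
    let ?t = "(\<lambda>p. if p = 1 then t1 else t2) :: nat \<Rightarrow> 'a"
    let ?s = "(\<lambda>(i, k). if i = 0 then (if k = 0 then a else b) else (if k = 0 then c else d)) :: nat \<times> nat \<Rightarrow> 'a"
    have ik: "(i = 0 \<or> i = 2) \<and> (k = 0 \<or> k = 1)" if "i < length ?c" "k < ?c ! i" for i k :: nat
      using that by (auto simp: less_Suc_eq numeral_eq_Suc)
    have p: "p = 1 \<or> p = 2" if "1 \<le> p" "p < length ?c" for p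
      using that by auto
    have ne: "a \<noteq> c" "a \<noteq> d" "b \<noteq> c" "b \<noteq> d" "a \<noteq> b" "c \<noteq> d" using lev d by auto
    have "embeds (T_seq ?c) D (case_sum ?t ?s)"
    proof (rule embeds_T_seqI)
      show "?t p \<in> T" if "1 \<le> p" "p < length ?c" for p
        using p[OF that] t1 t2 by auto
      show "level (?t p) < level (?t q)" if "1 \<le> p" "p < q" "q < length ?c" for p q
        using p[of p] p[of q] that t1 t2 by auto
      show "?s (i, k) \<in> S" if "i < length ?c" "k < ?c ! i" for i k
        using ik[OF that] S by auto
      have "{(i, k). i < length ?c \<and> k < ?c ! i} \<subseteq> {0, 2} \<times> {0, 1}"
        using ik by blast
      moreover have "inj_on ?s ({0, 2} \<times> {0, 1})"
        using ne by (auto simp: inj_on_def)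
      ultimately show "inj_on ?s {(i, k). i < length ?c \<and> k < ?c ! i}"
        by (rule inj_on_subset[rotated])
      show "level (?t p) \<le> level (?s (i, k')) \<longleftrightarrow> p \<le> i"
        if "i < length ?c" "k' < ?c ! i" "1 \<le> p" "p < length ?c" for i k' p
        using ik[OF that(1,2)] p[OF that(3,4)] t1 t2 k by auto
    qed
    then show False using free by blast
  qed
  show False if S: "a \<in> S" "b \<in> S" "c \<in> S" "d \<in> S"
    and lev: "level a < level b" "level b < level c" "level c < level d" for a b c d
  proof -
    \<comment> \<open>A clique vertex at position \<open>level b\<close> is an in-neighbour of
      \<open>b\<close> but not of \<open>a\<close>; likewise for \<open>c\<close> and
      \<open>d\<close>.\<close>
    obtain t1 where t1: "t1 \<in> T" "level t1 = level b"
      using level_obtain[of "level b"] lev level_le[of b] by auto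
    obtain t2 where t2: "t2 \<in> T" "level t2 = level c"
      using level_obtain[of "level c"] lev level_le[of c] by auto
    obtain t3 where t3: "t3 \<in> T" "level t3 = level d"
      using level_obtain[of "level d"] lev level_le[of d] by auto
    let ?c = "[1, 1, 1, 1 :: nat]"
    let ?t = "(\<lambda>p. if p = 1 then t1 else if p = 2 then t2 else t3) :: nat \<Rightarrow> 'a"
    let ?s = "(\<lambda>(i, k). if i = 0 then a else if i = 1 then b else if i = 2 then c else d) :: nat \<times> nat \<Rightarrow> 'a"
    have ik: "(i = 0 \<or> i = 1 \<or> i = 2 \<or> i = 3) \<and> k = 0"
      if "i < length ?c" "k < ?c ! i" for i k :: nat
      using that by (auto simp: less_Suc_eq numeral_eq_Suc)
    have p: "p = 1 \<or> p = 2 \<or> p = 3" if "1 \<le> p" "p < length ?c" for p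
      using that by auto
    have ne: "a \<noteq> b" "a \<noteq> c" "a \<noteq> d" "b \<noteq> c" "b \<noteq> d" "c \<noteq> d" using lev by auto
    have "embeds (T_seq ?c) D (case_sum ?t ?s)"
    proof (rule embeds_T_seqI)
      show "?t p \<in> T" if "1 \<le> p" "p < length ?c" for p
        using p[OF that] t1 t2 t3 by auto
      show "level (?t p) < level (?t q)" if "1 \<le> p" "p < q" "q < length ?c" for p q
        using p[of p] p[of q] that t1 t2 t3 lev by auto
      show "?s (i, k) \<in> S" if "i < length ?c" "k < ?c ! i" for i k
        using ik[OF that] S by auto
      have "{(i, k). i < length ?c \<and> k < ?c ! i} \<subseteq> {0, 1, 2, 3} \<times> {0}"
        using ik by blast
      moreover have "inj_on ?s ({0, 1, 2, 3} \<times> {0})"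
        using ne by (auto simp: inj_on_def)
      ultimately show "inj_on ?s {(i, k). i < length ?c \<and> k < ?c ! i}"
        by (rule inj_on_subset[rotated])
      show "level (?t p) \<le> level (?s (i, k')) \<longleftrightarrow> p \<le> i"
        if "i < length ?c" "k' < ?c ! i" "1 \<le> p" "p < length ?c" for i k' p
        using ik[OF that(1,2)] p[OF that(3,4)] t1 t2 t3 lev by auto
    qed
    then show False using free by blast
  qed
  show False if S: "a \<in> S" "b \<in> S" "c \<in> S"
    and lev: "level a + 2 \<le> level b" "level b + 2 \<le> level c" for a b c
  proof -
    \<comment> \<open>Each gap of 2 leaves room for two clique vertices right after the lower
      level.\<close>
    obtain t1 where t1: "t1 \<in> T" "level t1 = level a + 1"
      using level_obtain[of "level a + 1"] lev level_le[of b] by auto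
    obtain t2 where t2: "t2 \<in> T" "level t2 = level a + 2"
      using level_obtain[of "level a + 2"] lev level_le[of b] by auto
    obtain t3 where t3: "t3 \<in> T" "level t3 = level b + 1"
      using level_obtain[of "level b + 1"] lev level_le[of c] by auto
    obtain t4 where t4: "t4 \<in> T" "level t4 = level b + 2"
      using level_obtain[of "level b + 2"] lev level_le[of c] by auto
    let ?c = "[1, 0, 1, 0, 1 :: nat]"
    let ?t = "(\<lambda>p. if p = 1 then t1 else if p = 2 then t2 else if p = 3 then t3 else t4) :: nat \<Rightarrow> 'a"
    let ?s = "(\<lambda>(i, k). if i = 0 then a else if i = 2 then b else c) :: nat \<times> nat \<Rightarrow> 'a"
    have ik: "(i = 0 \<or> i = 2 \<or> i = 4) \<and> k = 0"
      if "i < length ?c" "k < ?c ! i" for i k :: nat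
      using that by (auto simp: less_Suc_eq numeral_eq_Suc)
    have p: "p = 1 \<or> p = 2 \<or> p = 3 \<or> p = 4" if "1 \<le> p" "p < length ?c" for p
      using that by auto
    have ne: "a \<noteq> b" "a \<noteq> c" "b \<noteq> c" using lev by auto
    have "embeds (T_seq ?c) D (case_sum ?t ?s)"
    proof (rule embeds_T_seqI)
      show "?t p \<in> T" if "1 \<le> p" "p < length ?c" for p
        using p[OF that] t1 t2 t3 t4 by auto
      show "level (?t p) < level (?t q)" if "1 \<le> p" "p < q" "q < length ?c" for p q
        using p[of p] p[of q] that t1 t2 t3 t4 lev by auto
      show "?s (i, k) \<in> S" if "i < length ?c" "k < ?c ! i" for i k
        using ik[OF that] S by auto
      have "{(i, k). i < length ?c \<and> k < ?c ! i} \<subseteq> {0, 2, 4} \<times> {0}"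
        using ik by blast
      moreover have "inj_on ?s ({0, 2, 4} \<times> {0})"
        using ne by (auto simp: inj_on_def)
      ultimately show "inj_on ?s {(i, k). i < length ?c \<and> k < ?c ! i}"
        by (rule inj_on_subset[rotated])
      show "level (?t p) \<le> level (?s (i, k')) \<longleftrightarrow> p \<le> i"
        if "i < length ?c" "k' < ?c ! i" "1 \<le> p" "p < length ?c" for i k' p
        using ik[OF that(1,2)] p[OF that(3,4)] t1 t2 t3 t4 lev by auto
    qed
    then show False using free by blast
  qed
qed

end

theorem theorem32:
  fixes D :: "'a pair_pre_digraph"
  assumes "pair_fin_digraph D"
    and "reflexive_multipartite_tournament D"
  shows "(strongly_chordal D \<longleftrightarrow>
            (\<exists>T S. transitive_split_orientation D T S) \<and> F_r_free D) \<and>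
         ((\<exists>T S. transitive_split_orientation D T S) \<and> F_r_free D \<longleftrightarrow>
            (\<exists>T S. transitive_split_orientation D T S \<and>
               (\<exists>i. card {s \<in> S. \<not> (in_level D T i s \<or> in_level D T (i + 1) s)} \<le> 1)))"
proof -
  have so: "split_orientation D T S" if "transitive_split_orientation D T S" for T S
    using assms(1) that by (rule split_orientation.intro)
  \<comment> \<open>Both equivalences hold for every split partition, so the partitions on the two
    sides of the theorem need not coincide.\<close>
  have free: "F_r_free D \<longleftrightarrow>
      (\<exists>i. card {s \<in> S. \<not> (in_level D T i s \<or> in_level D T (i + 1) s)} \<le> 1)"
    and chordal: "strongly_chordal D \<longleftrightarrow>
      (\<exists>i. card {s \<in> S. \<not> (in_level D T i s \<or> in_level D T (i + 1) s)} \<le> 1)"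
    if "transitive_split_orientation D T S" for T S
  proof -
    interpret split_orientation D T S by (rule so[OF that])
    show "F_r_free D \<longleftrightarrow>
      (\<exists>i. card {s \<in> S. \<not> (in_level D T i s \<or> in_level D T (i + 1) s)} \<le> 1)"
      using F_r_free_imp_two_levels two_levels_imp_F_r_free two_levels_but_one_iff by blast
    show "strongly_chordal D \<longleftrightarrow>
      (\<exists>i. card {s \<in> S. \<not> (in_level D T i s \<or> in_level D T (i + 1) s)} \<le> 1)"
      using strongly_chordal_imp_two_levels two_levels_imp_strongly_chordal two_levels_but_one_iff by blast
  qed
  show ?thesis
    using free chordal strongly_chordal_imp_split_orientation[OF assms] by metis
qed

end
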